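(* Let $H$ be a duo monoid. (1) If $H$ is Archimedean, then every non-trivial divisor-closed submonoid of $\mathfrak{I}_{\mathrm{fin}}(H)$ contains $\mathfrak{P}(H)$. (2) Conversely, if $H$ is cancellative and every non-trivial divisor-closed submonoid of $\mathfrak{I}_{\mathrm{fin}}(H)$ contains $\mathfrak{P}(H)$, then $H$ is Archimedean.
   Context: Monoids are written multiplicatively. For subsets $X,Y$ of $H$, $XY:=\{xy : x\in X,\ y\in Y\}$, and braces of singletons are omitted in such products (e.g. $HaH = H\{a\}H$). A monoid $H$ is: cancellative if $ax\ne ay$ and $xa\neq ya$ for all $a,x,y\in H$ with $x\ne y$; duo if $aH=Ha$ for every $a\in H$; Archimedean if, for all $a,b\in H$ such that $b$ is not a unit, there is an integer $k\ge 1$ with $b^k\in HaH$. An ideal of $H$ is a non-empty set $I\subseteq H$ with $IH\subseteq I$ and $HI\subseteq I$. The ideals of $H$ form a monoid $\mathfrak{I}(H)$ under setwise multiplication, with identity $H$. An ideal is finitely generated if it is of the form $HXH$ for some non-empty finite $X\subseteq H$, and principal if it is of the form $HxH$ with $x\in H$. $\mathfrak{I}_{\mathrm{fin}}(H)$ is the submonoid of $\mathfrak{I}(H)$ generated by the finitely generated ideals, and $\mathfrak{P}(H)$ is the submonoid generated by the principal ideals. For a monoid $M$ and $x,y\in M$, $x$ divides $y$ in $M$ (written $x\mid_M y$) if $y\in MxM$. A submonoid $T$ of $M$ is divisor-closed if $x\mid_M y$ and $y\in T$ imply $x\in T$; it is trivial if $T=\{1_M\}$. Thus a submonoid of $\mathfrak{I}_{\mathrm{fin}}(H)$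 is trivial if it equals $\{H\}$. *)

theory Defs
  imports "HOL-Algebra.Coset" "HOL-Algebra.Divisibility"
begin

locale duo_monoid = monoid +
  assumes duo: "a \<in> carrier G \<Longrightarrow> a <# carrier G = carrier G #> a"

definition two_sided :: "('a, 'b) monoid_scheme \<Rightarrow> 'a set \<Rightarrow> 'a set"
  where "two_sided H X = carrier H <#>\<^bsub>H\<^esub> X <#>\<^bsub>H\<^esub> carrier H"

definition archimedean_monoid :: "('a, 'b) monoid_scheme \<Rightarrow> bool"
  where "archimedean_monoid H \<longleftrightarrow>
    (\<forall>a\<in>carrier H. \<forall>b\<in>carrier H. b \<notin> Units H \<longrightarrow>
      (\<exists>k::nat. k \<ge> 1 \<and> b [^]\<^bsub>H\<^esub> k \<in> two_sided H {a}))"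

definition monoid_ideal :: "('a, 'b) monoid_scheme \<Rightarrow> 'a set \<Rightarrow> bool"
  where "monoid_ideal H I \<longleftrightarrow>
    I \<subseteq> carrier H \<and> I \<noteq> {} \<and>
    I <#>\<^bsub>H\<^esub> carrier H \<subseteq> I \<and> carrier H <#>\<^bsub>H\<^esub> I \<subseteq> I"

definition ideal_monoid :: "('a, 'b) monoid_scheme \<Rightarrow> 'a set monoid"
  where "ideal_monoid H =
    \<lparr>carrier = {I. monoid_ideal H I}, mult = (<#>\<^bsub>H\<^esub>), one = carrier H\<rparr>"

definition fin_gen_ideals :: "('a, 'b) monoid_scheme \<Rightarrow> 'a set set"
  where "fin_gen_ideals H =
    {two_sided H X | X. finite X \<and> X \<noteq> {} \<and> X \<subseteq> carrier H}"

definition principal_ideals :: "('a, 'b) monoid_scheme \<Rightarrow> 'a set set"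
  where "principal_ideals H = {two_sided H {x} | x. x \<in> carrier H}"

(* The library's generate also closes under inverses, hence the separate notion. *)
inductive_set submonoid_gen :: "('a, 'b) monoid_scheme \<Rightarrow> 'a set \<Rightarrow> 'a set"
  for M and S where
    one: "\<one>\<^bsub>M\<^esub> \<in> submonoid_gen M S"
  | incl: "x \<in> S \<Longrightarrow> x \<in> submonoid_gen M S"
  | mult: "x \<in> submonoid_gen M S \<Longrightarrow> y \<in> submonoid_gen M S \<Longrightarrow>
           x \<otimes>\<^bsub>M\<^esub> y \<in> submonoid_gen M S"

definition fin_ideal_monoid :: "('a, 'b) monoid_scheme \<Rightarrow> 'a set monoid"
  where "fin_ideal_monoid H =
    (ideal_monoid H)\<lparr>carrier := submonoid_gen (ideal_monoid H) (fin_gen_ideals H)\<rparr>"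

definition principal_ideal_submonoid :: "('a, 'b) monoid_scheme \<Rightarrow> 'a set set"
  where "principal_ideal_submonoid H = submonoid_gen (ideal_monoid H) (principal_ideals H)"

(* The library's divides is one-sided: y in xM. *)
definition divides_two_sided :: "('a, 'b) monoid_scheme \<Rightarrow> 'a \<Rightarrow> 'a \<Rightarrow> bool"
  where "divides_two_sided M x y \<longleftrightarrow> y \<in> two_sided M {x}"

definition divisor_closed_submonoid :: "'a set \<Rightarrow> ('a, 'b) monoid_scheme \<Rightarrow> bool"
  where "divisor_closed_submonoid T M \<longleftrightarrow>
    submonoid T M \<and>
    (\<forall>x\<in>carrier M. \<forall>y\<in>T. divides_two_sided M x y \<longrightarrow> x \<in> T)"

lemma submonoid_gen_least:
  assumes "submonoid T M" "S \<subseteq> T"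
  shows "submonoid_gen M S \<subseteq> T"
proof
  fix x assume "x \<in> submonoid_gen M S"
  then show "x \<in> T"
    by induction (use assms in \<open>auto intro: submonoid.m_closed submonoid.one_closed\<close>)
qed

context monoid
begin

lemma submonoid_carrier: "submonoid (carrier G) G"
  by unfold_locales auto

lemma submonoid_submonoid_gen:
  assumes "S \<subseteq> carrier G"
  shows "submonoid (submonoid_gen G S) G"
  using submonoid_gen_least[OF submonoid_carrier assms]
  by (auto intro!: submonoid.intro intro: submonoid_gen.intros)

lemma set_mult_assoc_monoid:
  assumes "A \<subseteq> carrier G" "B \<subseteq> carrier G" "C \<subseteq> carrier G"
  shows "(A <#> B) <#> C = A <#> (B <#> C)"
proof -
  have "x \<otimes> y \<otimes> z = x \<otimes> (y \<otimes> z)" if "x \<in> A" "y \<in> B" "z \<in> C" for x y z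
    using that assms by (auto intro: m_assoc)
  then show ?thesis unfolding set_mult_def by force
qed

lemma subset_mult_carrier: "A \<subseteq> carrier G \<Longrightarrow> A \<subseteq> A <#> carrier G"
  unfolding set_mult_def by (force intro: r_one[symmetric])

lemma subset_carrier_mult: "A \<subseteq> carrier G \<Longrightarrow> A \<subseteq> carrier G <#> A"
  unfolding set_mult_def by (force intro: l_one[symmetric])

lemma monoid_ideal_set_mult:
  assumes "monoid_ideal G I" "monoid_ideal G J"
  shows "monoid_ideal G (I <#> J)"
proof -
  have I: "I \<subseteq> carrier G" "I \<noteq> {}" "carrier G <#> I \<subseteq> I"
    and J: "J \<subseteq> carrier G" "J \<noteq> {}" "J <#> carrier G \<subseteq> J"
    using assms by (auto simp: monoid_ideal_def)
  have "(I <#> J) <#> carrier G \<subseteq> I <#> J"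
    using I J by (simp add: set_mult_assoc_monoid mono_set_mult)
  moreover have "carrier G <#> (I <#> J) \<subseteq> I <#> J"
    using I J by (simp add: mono_set_mult flip: set_mult_assoc_monoid)
  moreover have "I <#> J \<noteq> {}"
    using I(2) J(2) by (auto simp: set_mult_def)
  ultimately show ?thesis
    using set_mult_closed[OF I(1) J(1)] by (simp add: monoid_ideal_def)
qed

lemma monoid_ideal_carrier: "monoid_ideal G (carrier G)"
  by (auto simp: monoid_ideal_def set_mult_def)

lemma monoid_ideal_monoid: "monoid (ideal_monoid G)"
proof (rule monoidI)
  fix I J K
  assume "I \<in> carrier (ideal_monoid G)" "J \<in> carrier (ideal_monoid G)"
    "K \<in> carrier (ideal_monoid G)"
  then show "I \<otimes>\<^bsub>ideal_monoid G\<^esub> J \<otimes>\<^bsub>ideal_monoid G\<^esub> K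
      = I \<otimes>\<^bsub>ideal_monoid G\<^esub> (J \<otimes>\<^bsub>ideal_monoid G\<^esub> K)"
    by (simp add: ideal_monoid_def set_mult_assoc_monoid monoid_ideal_def)
next
  fix I assume "I \<in> carrier (ideal_monoid G)"
  then have I: "I \<subseteq> carrier G" "I <#> carrier G \<subseteq> I" "carrier G <#> I \<subseteq> I"
    by (auto simp: ideal_monoid_def monoid_ideal_def)
  show "\<one>\<^bsub>ideal_monoid G\<^esub> \<otimes>\<^bsub>ideal_monoid G\<^esub> I = I"
    using I subset_carrier_mult[OF I(1)] by (simp add: ideal_monoid_def subset_antisym)
  show "I \<otimes>\<^bsub>ideal_monoid G\<^esub> \<one>\<^bsub>ideal_monoid G\<^esub> = I"
    using I subset_mult_carrier[OF I(1)] by (simp add: ideal_monoid_def subset_antisym)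
qed (auto simp: ideal_monoid_def monoid_ideal_set_mult monoid_ideal_carrier)

lemma monoid_ideal_two_sided:
  assumes "X \<subseteq> carrier G" "X \<noteq> {}"
  shows "monoid_ideal G (two_sided G X)"
proof -
  let ?H = "carrier G"
  have HH: "?H <#> ?H \<subseteq> ?H" by (auto simp: set_mult_def)
  have c: "?H <#> X \<subseteq> ?H" "X <#> ?H \<subseteq> ?H"
    using assms(1) by (simp_all add: set_mult_closed)
  have "?H <#> X <#> ?H <#> ?H \<subseteq> ?H <#> X <#> ?H"
    using c HH by (simp add: set_mult_assoc_monoid mono_set_mult)
  moreover have "?H <#> (?H <#> X <#> ?H) \<subseteq> ?H <#> X <#> ?H"
  proof -
    have "?H <#> (?H <#> X <#> ?H) = ?H <#> ?H <#> (X <#> ?H)"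
      using c assms(1) by (simp add: set_mult_assoc_monoid)
    also have "\<dots> \<subseteq> ?H <#> (X <#> ?H)"
      by (intro mono_set_mult HH order_refl)
    finally show ?thesis
      using c assms(1) by (simp add: set_mult_assoc_monoid)
  qed
  moreover have "X \<subseteq> ?H <#> X <#> ?H"
    using subset_carrier_mult[OF assms(1)] subset_mult_carrier[OF c(1)] by blast
  ultimately show ?thesis
    using assms set_mult_closed[OF c(1) order_refl]
    by (auto simp: monoid_ideal_def two_sided_def)
qed

lemma monoid_fin_ideal_monoid: "monoid (fin_ideal_monoid G)"
proof -
  have "fin_gen_ideals G \<subseteq> carrier (ideal_monoid G)"
    unfolding fin_gen_ideals_def ideal_monoid_def
    by (auto intro!: monoid_ideal_two_sided simp del: ex_in_conv)
  then show ?thesis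
    unfolding fin_ideal_monoid_def
    by (intro submonoid.submonoid_is_monoid monoid.submonoid_submonoid_gen monoid_ideal_monoid)
qed

end

end

theory Submission
  imports Defs
begin

text \<open>
  In a duo monoid two-sided ideals are right ideals and \<open>(XH)(YH) = XYH\<close>, so every element of
  the monoid generated by the finitely generated ideals is itself of the form \<open>XH\<close> with \<open>X\<close> finite.

  If \<open>H\<close> is Archimedean and \<open>XH \<noteq> H\<close>, then \<open>X\<close> consists of non-units, so for any \<open>a\<close> and
  each \<open>x \<in> X\<close> some power of \<open>x\<close>, with exponent \<open>e x\<close>, lies in \<open>aH\<close>. By pigeonhole a product
  of \<open>n = (\<Sum>x\<in>X. e x)\<close> elements of \<open>X\<close> contains some \<open>x\<close> at least \<open>e x\<close> times, hence lies
  in \<open>aH\<close>. Thus the \<open>n\<close>-th power of \<open>XH\<close> is contained in \<open>aH\<close>, and for finitely generated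
  ideals inclusion in \<open>aH\<close> means divisibility by \<open>aH\<close>.

  If \<open>H\<close> is cancellative, all ideals dividing a principal ideal are principal. Hence, for a non-unit
  \<open>b\<close>, the ideals \<open>xH\<close> with \<open>x\<close> dividing a power of \<open>b\<close> form a non-trivial divisor-closed submonoid.
  If this contains \<open>aH\<close>, then \<open>a\<close> divides a power of \<open>b\<close>.
\<close>

context duo_monoid
begin

section \<open>Generating sets of ideals in a duo monoid\<close>

lemma ex_mult_commute_left:
  assumes "a \<in> carrier G" "h \<in> carrier G"
  obtains h' where "h' \<in> carrier G" "h \<otimes> a = a \<otimes> h'"
proof -
  have "h \<otimes> a \<in> a <# carrier G"
    using assms duo by (auto simp: r_coset_def)
  then show thesis using that by (auto simp: l_coset_def)
qed

lemma ex_mult_commute_right: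
  assumes "a \<in> carrier G" "h \<in> carrier G"
  obtains h' where "h' \<in> carrier G" "a \<otimes> h = h' \<otimes> a"
proof -
  have "a \<otimes> h \<in> carrier G #> a"
    using assms by (auto simp: l_coset_def simp flip: duo)
  then show thesis using that by (auto simp: r_coset_def)
qed

lemma two_sided_eq:
  assumes "X \<subseteq> carrier G"
  shows "two_sided G X = X <#> carrier G"
proof
  show "two_sided G X \<subseteq> X <#> carrier G"
  proof
    fix z assume "z \<in> two_sided G X"
    then obtain h x k where z: "h \<in> carrier G" "x \<in> X" "k \<in> carrier G" "z = h \<otimes> x \<otimes> k"
      by (auto simp: two_sided_def set_mult_def)
    with assms obtain h' where "h' \<in> carrier G" "h \<otimes> x = x \<otimes> h'"
      by (meson ex_mult_commute_left subsetD)
    with z assms have "z = x \<otimes> (h' \<otimes> k)" "h' \<otimes> k \<in> carrier G"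
      by (auto simp: m_assoc subset_iff)
    with z(2) show "z \<in> X <#> carrier G"
      by (auto simp: set_mult_def)
  qed
  show "X <#> carrier G \<subseteq> two_sided G X"
    unfolding two_sided_def by (intro mono_set_mult subset_carrier_mult assms order_refl)
qed

lemma mem_two_sided_iff:
  "X \<subseteq> carrier G \<Longrightarrow> z \<in> two_sided G X \<longleftrightarrow> (\<exists>x\<in>X. \<exists>h\<in>carrier G. z = x \<otimes> h)"
  by (auto simp: two_sided_eq set_mult_def)

lemma mem_two_sided_singleton_iff:
  "a \<in> carrier G \<Longrightarrow> z \<in> two_sided G {a} \<longleftrightarrow> (\<exists>h\<in>carrier G. z = a \<otimes> h)"
  by (simp add: mem_two_sided_iff)

lemma subset_two_sided: "X \<subseteq> carrier G \<Longrightarrow> X \<subseteq> two_sided G X"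
  by (simp add: two_sided_eq subset_mult_carrier)

lemma two_sided_mono: "X \<subseteq> Y \<Longrightarrow> two_sided G X \<subseteq> two_sided G Y"
  unfolding two_sided_def by (intro mono_set_mult order_refl)

lemma two_sided_set_mult:
  assumes "X \<subseteq> carrier G" "Y \<subseteq> carrier G"
  shows "two_sided G X <#> two_sided G Y = two_sided G (X <#> Y)"
proof -
  \<comment> \<open>Regrouping exposes HYH in the middle of XHYH; by the duo law it collapses to
    YH.\<close>
  have "X <#> carrier G <#> (Y <#> carrier G) = X <#> two_sided G Y"
    using assms by (simp add: two_sided_def set_mult_assoc_monoid set_mult_closed)
  also have "\<dots> = X <#> Y <#> carrier G"
    using assms by (simp add: two_sided_eq set_mult_assoc_monoid)
  finally show ?thesis
    using assms by (simp add: two_sided_eq set_mult_closed)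
qed

lemma two_sided_singleton_mult:
  assumes "x \<in> carrier G" "y \<in> carrier G"
  shows "two_sided G {x} <#> two_sided G {y} = two_sided G {x \<otimes> y}"
  using assms by (simp add: two_sided_set_mult) (simp add: set_mult_def)

lemma two_sided_one: "two_sided G {\<one>} = carrier G"
  by (auto simp: mem_two_sided_singleton_iff)

lemma two_sided_singleton_eq_carrier_iff:
  assumes "x \<in> carrier G"
  shows "two_sided G {x} = carrier G \<longleftrightarrow> x \<in> Units G"
proof
  assume "two_sided G {x} = carrier G"
  then obtain h where h: "h \<in> carrier G" "\<one> = x \<otimes> h"
    using assms mem_two_sided_singleton_iff one_closed by metis
  \<comment> \<open>So far \<open>x\<close> has only a right inverse; since xH = Hx, it has a left
    inverse too.\<close>
  then obtain h' where h': "h' \<in> carrier G" "\<one> = h' \<otimes> x"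
    using assms ex_mult_commute_right by metis
  have "h' = h"
    using h h' assms by (metis m_assoc l_one r_one)
  with h h' assms show "x \<in> Units G"
    by (auto simp: Units_def)
next
  assume x: "x \<in> Units G"
  have "z \<in> two_sided G {x}" if "z \<in> carrier G" for z
  proof -
    have "z = x \<otimes> (inv x \<otimes> z)"
      using that assms x by (simp add: Units_inv_closed flip: m_assoc)
    moreover have "inv x \<otimes> z \<in> carrier G"
      using that x by simp
    ultimately show ?thesis
      unfolding mem_two_sided_singleton_iff[OF assms] by blast
  qed
  then show "two_sided G {x} = carrier G"
    using assms by (auto simp: mem_two_sided_singleton_iff)
qed

section \<open>The monoid of finitely generated ideals\<close>

text \<open>XY is finite whenever X and Y are, so products of generators give no new ideals. Every
  element of the monoid may therefore be taken with a finite generating set.\<close>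

lemma fin_gen_ideals_carrier: "carrier (fin_ideal_monoid G) = fin_gen_ideals G"
proof -
  have "I \<in> fin_gen_ideals G"
    if "I \<in> submonoid_gen (ideal_monoid G) (fin_gen_ideals G)" for I
    using that
  proof induction
    case one
    show ?case
      unfolding fin_gen_ideals_def ideal_monoid_def
      by (auto simp: two_sided_one intro!: exI[of _ "{\<one>}"])
  next
    case (mult I J)
    then obtain X Y where
      X: "I = two_sided G X" "finite X" "X \<noteq> {}" "X \<subseteq> carrier G" and
      Y: "J = two_sided G Y" "finite Y" "Y \<noteq> {}" "Y \<subseteq> carrier G"
      by (auto simp: fin_gen_ideals_def)
    have "finite (X <#> Y)" "X <#> Y \<noteq> {}" "X <#> Y \<subseteq> carrier G"
      using X Y set_mult_closed by (auto simp: set_mult_def)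
    moreover have "I \<otimes>\<^bsub>ideal_monoid G\<^esub> J = two_sided G (X <#> Y)"
      using X Y by (simp add: ideal_monoid_def two_sided_set_mult)
    ultimately show ?case
      unfolding fin_gen_ideals_def by blast
  qed
  then show ?thesis
    by (auto simp: fin_ideal_monoid_def intro: submonoid_gen.incl)
qed

lemma mult_fin_ideal_monoid: "I \<otimes>\<^bsub>fin_ideal_monoid G\<^esub> J = I <#> J"
  by (simp add: fin_ideal_monoid_def ideal_monoid_def)

lemma one_fin_ideal_monoid: "\<one>\<^bsub>fin_ideal_monoid G\<^esub> = carrier G"
  by (simp add: fin_ideal_monoid_def ideal_monoid_def)

lemma principal_ideals_subset_fin_gen_ideals: "principal_ideals G \<subseteq> fin_gen_ideals G"
  by (auto simp: principal_ideals_def fin_gen_ideals_def)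

lemma monoid_ideal_fin_gen: "I \<in> fin_gen_ideals G \<Longrightarrow> monoid_ideal G I"
  by (auto simp: fin_gen_ideals_def simp del: ex_in_conv intro!: monoid_ideal_two_sided)

section \<open>Archimedean monoids: powers of proper ideals\<close>

text \<open>Each of the finitely many generators of \<open>I\<close> is a multiple of
  \<open>a\<close>; one chosen quotient for each of them generates \<open>J\<close>.\<close>

lemma fin_gen_ideal_subset_principal_factor:
  assumes "I \<in> fin_gen_ideals G" "a \<in> carrier G" "I \<subseteq> two_sided G {a}"
  obtains J where "J \<in> fin_gen_ideals G" "I = two_sided G {a} <#> J"
proof -
  obtain Z where Z: "finite Z" "Z \<noteq> {}" "Z \<subseteq> carrier G" "I = two_sided G Z"
    using assms(1) by (auto simp: fin_gen_ideals_def)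
  have "\<exists>y. y \<in> carrier G \<and> z = a \<otimes> y" if "z \<in> Z" for z
  proof -
    have "z \<in> I"
      using that Z subset_two_sided by blast
    with assms(3) have "z \<in> two_sided G {a}" by blast
    with assms(2) show ?thesis
      by (auto simp: mem_two_sided_singleton_iff)
  qed
  then obtain f where f: "\<And>z. z \<in> Z \<Longrightarrow> f z \<in> carrier G" "\<And>z. z \<in> Z \<Longrightarrow> z = a \<otimes> f z"
    by metis
  have "{a} <#> f ` Z = (\<lambda>z. a \<otimes> f z) ` Z"
    by (auto simp: set_mult_def)
  also have "\<dots> = Z"
    using f(2) by (simp flip: f(2))
  finally have "I = two_sided G {a} <#> two_sided G (f ` Z)"
    using assms(2) f(1) Z by (simp add: two_sided_set_mult image_subset_iff)
  moreover have "two_sided G (f ` Z) \<in> fin_gen_ideals G"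
    using f(1) Z by (auto simp: fin_gen_ideals_def)
  ultimately show thesis using that by blast
qed

text \<open>The number \<open>c x\<close> counts the factors \<open>x\<close> in a product of \<open>n\<close> generators.\<close>

lemma power_two_sided_multiplicities:
  fixes n :: nat
  assumes "finite X" "X \<subseteq> carrier G" "w \<in> two_sided G X [^]\<^bsub>fin_ideal_monoid G\<^esub> n"
  shows "\<exists>c :: 'a \<Rightarrow> nat. (\<Sum>x\<in>X. c x) = n \<and> (\<forall>x\<in>X. w \<in> two_sided G {x [^] c x})"
  using assms(3)
proof (induction n arbitrary: w)
  case 0
  then have "w \<in> carrier G"
    by (simp add: one_fin_ideal_monoid)
  then show ?case
    by (intro exI[of _ "\<lambda>_. 0"]) (simp add: two_sided_one)
next
  case (Suc n)
  then obtain v u where vu: "v \<in> two_sided G X [^]\<^bsub>fin_ideal_monoid G\<^esub> n" "u \<in> two_sided G X"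
    "w = v \<otimes> u"
    by (auto simp: mult_fin_ideal_monoid set_mult_def)
  from Suc.IH[OF vu(1)] obtain c :: "'a \<Rightarrow> nat" where
    c: "(\<Sum>x\<in>X. c x) = n" "\<And>x. x \<in> X \<Longrightarrow> v \<in> two_sided G {x [^] c x}"
    by blast
  obtain y k where y: "y \<in> X" "k \<in> carrier G" "u = y \<otimes> k"
    using vu(2) assms(2) by (auto simp: mem_two_sided_iff)
  have yG: "y \<in> carrier G" using y assms by auto
  \<comment> \<open>The last factor lies in yH, so only the count of \<open>y\<close> goes
    up.\<close>
  let ?d = "c(y := Suc (c y))"
  have "(\<Sum>x\<in>X. ?d x) = Suc n"
    using assms(1) y(1) c(1) by (simp add: sum.remove[of X y])
  moreover have "w \<in> two_sided G {x [^] ?d x}" if x: "x \<in> X" for x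
  proof -
    have xG: "x \<in> carrier G" using x assms by auto
    obtain h where h: "h \<in> carrier G" "v = x [^] c x \<otimes> h"
      using c(2)[OF x] xG by (auto simp: mem_two_sided_singleton_iff)
    show ?thesis
    proof (cases "x = y")
      case True
      \<comment> \<open>The new \<open>y\<close> must pass the cofactor \<open>h\<close> to join the
        power of \<open>y\<close> on the left.\<close>
      obtain h' where "h' \<in> carrier G" "h \<otimes> y = y \<otimes> h'"
        using ex_mult_commute_left[OF yG h(1)] by metis
      then have "w = y [^] Suc (c y) \<otimes> (h' \<otimes> k)" "h' \<otimes> k \<in> carrier G"
        using True h y yG vu(3) by (simp_all add: m_assoc) (simp flip: m_assoc)
      then show ?thesis
        using True yG by (auto simp: mem_two_sided_singleton_iff simp del: nat_pow_Suc)
    next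
      case False
      have "w = x [^] c x \<otimes> (h \<otimes> (y \<otimes> k))" "h \<otimes> (y \<otimes> k) \<in> carrier G"
        using xG yG h y vu(3) by (simp_all add: m_assoc)
      then show ?thesis
        using False xG by (auto simp: mem_two_sided_singleton_iff)
    qed
  qed
  ultimately show ?case by blast
qed

text \<open>A divisor of x^k divides all higher powers, since x^m = x^k x^(m-k). With
  \<open>k\<close> and \<open>m\<close> equal to 1 this is transitivity of divisibility.\<close>

lemma two_sided_power_mono:
  fixes k m :: nat
  assumes "x \<in> carrier G" "a \<in> carrier G" "x [^] k \<in> two_sided G {a}" "k \<le> m"
  shows "two_sided G {x [^] m} \<subseteq> two_sided G {a}"
proof
  fix z assume "z \<in> two_sided G {x [^] m}"
  then obtain h where h: "h \<in> carrier G" "z = x [^] m \<otimes> h"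
    using assms by (auto simp: mem_two_sided_singleton_iff)
  obtain g where g: "g \<in> carrier G" "x [^] k = a \<otimes> g"
    using assms by (auto simp: mem_two_sided_singleton_iff)
  have "x [^] m = x [^] k \<otimes> x [^] (m - k)"
    using assms(1,4) by (simp add: nat_pow_mult)
  with g h assms have "z = a \<otimes> (g \<otimes> x [^] (m - k) \<otimes> h)"
    by (simp add: m_assoc)
  then show "z \<in> two_sided G {a}"
    using g h assms by (auto simp: mem_two_sided_singleton_iff)
qed

lemma archimedean_power_subset_principal:
  assumes "archimedean_monoid G" "I \<in> fin_gen_ideals G" "I \<noteq> carrier G" "a \<in> carrier G"
  obtains n :: nat where "I [^]\<^bsub>fin_ideal_monoid G\<^esub> n \<subseteq> two_sided G {a}"
proof -
  obtain X where X: "I = two_sided G X" "finite X" "X \<noteq> {}" "X \<subseteq> carrier G"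
    using assms(2) by (auto simp: fin_gen_ideals_def)
  \<comment> \<open>A unit among the generators would force \<open>I\<close> to be all of H.\<close>
  have "x \<notin> Units G" if "x \<in> X" for x
  proof
    assume "x \<in> Units G"
    then have "carrier G = two_sided G {x}"
      using that X two_sided_singleton_eq_carrier_iff by auto
    also have "\<dots> \<subseteq> I"
      using that X by (simp add: two_sided_mono)
    finally show False
      using assms(2,3) monoid_ideal_fin_gen unfolding monoid_ideal_def by blast
  qed
  then have "\<exists>k::nat. x [^] k \<in> two_sided G {a}" if "x \<in> X" for x
    using assms(1,4) X(4) that unfolding archimedean_monoid_def by blast
  then obtain e :: "'a \<Rightarrow> nat" where e: "\<And>x. x \<in> X \<Longrightarrow> x [^] e x \<in> two_sided G {a}"
    by metis
  have "I [^]\<^bsub>fin_ideal_monoid G\<^esub> (\<Sum>x\<in>X. e x) \<subseteq> two_sided G {a}"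
  proof
    fix w assume "w \<in> I [^]\<^bsub>fin_ideal_monoid G\<^esub> (\<Sum>x\<in>X. e x)"
    from power_two_sided_multiplicities[OF X(2,4) this[unfolded X(1)]]
    obtain c where c: "(\<Sum>x\<in>X. c x) = (\<Sum>x\<in>X. e x)" "\<And>x. x \<in> X \<Longrightarrow> w \<in> two_sided G {x [^] c x}"
      by blast
    have "\<exists>x\<in>X. e x \<le> c x"
    proof (rule ccontr)
      \<comment> \<open>Termwise c x < e x gives strictly smaller sums because \<open>X\<close> is
        finite and non-empty.\<close>
      assume "\<not> ?thesis"
      then have "(\<Sum>x\<in>X. c x) < (\<Sum>x\<in>X. e x)"
        using X by (intro sum_strict_mono) auto
      with c(1) show False by simp
    qed
    then obtain x where "x \<in> X" "e x \<le> c x" by blast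
    then show "w \<in> two_sided G {a}"
      using two_sided_power_mono[OF _ assms(4) e] c(2) X(4) by blast
  qed
  then show thesis by (rule that)
qed

lemma archimedean_divisor_closed_contains_principal:
  assumes arch: "archimedean_monoid G"
    and T: "divisor_closed_submonoid T (fin_ideal_monoid G)" "T \<noteq> {\<one>\<^bsub>fin_ideal_monoid G\<^esub>}"
  shows "principal_ideal_submonoid G \<subseteq> T"
proof -
  interpret F: monoid "fin_ideal_monoid G" by (rule monoid_fin_ideal_monoid)
  interpret T: submonoid T "fin_ideal_monoid G"
    using T(1) by (simp add: divisor_closed_submonoid_def)
  obtain I where I: "I \<in> T" "I \<noteq> carrier G"
    using T(2) T.one_closed unfolding one_fin_ideal_monoid by blast
  have pow: "I [^]\<^bsub>fin_ideal_monoid G\<^esub> n \<in> T" for n :: nat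
    by (induction n) (use I in auto)
  have "two_sided G {a} \<in> T" if a: "a \<in> carrier G" for a
  proof -
    have I': "I \<in> fin_gen_ideals G"
      using I(1) T.subset fin_gen_ideals_carrier by blast
    obtain n :: nat where "I [^]\<^bsub>fin_ideal_monoid G\<^esub> n \<subseteq> two_sided G {a}"
      using archimedean_power_subset_principal[OF arch I' I(2) a] .
    moreover have "I [^]\<^bsub>fin_ideal_monoid G\<^esub> n \<in> fin_gen_ideals G"
      using pow T.subset fin_gen_ideals_carrier by blast
    ultimately obtain J where J: "J \<in> fin_gen_ideals G"
      "I [^]\<^bsub>fin_ideal_monoid G\<^esub> n = two_sided G {a} <#> J"
      using fin_gen_ideal_subset_principal_factor a by metis
    have aF: "two_sided G {a} \<in> carrier (fin_ideal_monoid G)"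
      using a principal_ideals_subset_fin_gen_ideals
      by (auto simp: fin_gen_ideals_carrier principal_ideals_def)
    \<comment> \<open>Divisibility is two-sided, so the identity serves as the left
      cofactor.\<close>
    have "I [^]\<^bsub>fin_ideal_monoid G\<^esub> n
        = \<one>\<^bsub>fin_ideal_monoid G\<^esub> \<otimes>\<^bsub>fin_ideal_monoid G\<^esub> two_sided G {a} \<otimes>\<^bsub>fin_ideal_monoid G\<^esub> J"
      using aF J(2) F.l_one by (simp add: mult_fin_ideal_monoid)
    then have "divides_two_sided (fin_ideal_monoid G) (two_sided G {a})
        (I [^]\<^bsub>fin_ideal_monoid G\<^esub> n)"
      unfolding divides_two_sided_def two_sided_def[of "fin_ideal_monoid G"]
      using J(1) F.one_closed fin_gen_ideals_carrier by (auto simp: set_mult_def)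
    then show ?thesis
      using T(1) aF pow unfolding divisor_closed_submonoid_def by blast
  qed
  then have "principal_ideals G \<subseteq> T"
    by (auto simp: principal_ideals_def)
  \<comment> \<open>The principal ideals generate their submonoid inside
    \<open>ideal_monoid G\<close>, so minimality is applied with \<open>T\<close> viewed in that
    larger monoid.\<close>
  moreover have "submonoid T (ideal_monoid G)"
    using T.subset T.m_closed T.one_closed monoid_ideal_fin_gen
    unfolding fin_gen_ideals_carrier
    by unfold_locales (auto simp: fin_ideal_monoid_def ideal_monoid_def)
  ultimately show ?thesis
    unfolding principal_ideal_submonoid_def by (intro submonoid_gen_least)
qed

section \<open>Cancellative monoids: divisors of principal ideals\<close>

text \<open>Write x = uvw with factors from \<open>I\<close>, \<open>J\<close>, \<open>K\<close>.
  For any j in \<open>J\<close>, the product ujw lies in IJK = xH, and cancelling \<open>u\<close>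
  and \<open>w\<close> leaves j in vH.\<close>

lemma cancel_divisor_of_principal_ideal:
  assumes "monoid_cancel G" "monoid_ideal G I" "monoid_ideal G J" "monoid_ideal G K"
    and x: "x \<in> carrier G" "I <#> J <#> K = two_sided G {x}"
  obtains v where "v \<in> carrier G" "J = two_sided G {v}" "x \<in> two_sided G {v}"
proof -
  interpret monoid_cancel G by fact
  have sub: "I \<subseteq> carrier G" "J \<subseteq> carrier G" "K \<subseteq> carrier G"
    using assms by (auto simp: monoid_ideal_def)
  have abs: "j \<otimes> h \<in> J" if "j \<in> J" "h \<in> carrier G" for j h
    using that assms(3) by (auto simp: monoid_ideal_def set_mult_def)
  have "x \<in> I <#> J <#> K"
    using x subset_two_sided[of "{x}"] by simp
  then obtain u v w where uvw: "u \<in> I" "v \<in> J" "w \<in> K" "x = u \<otimes> v \<otimes> w"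
    by (auto simp: set_mult_def)
  then have c: "u \<in> carrier G" "v \<in> carrier G" "w \<in> carrier G" using sub by auto
  have "j \<in> two_sided G {v}" if j: "j \<in> J" for j
  proof -
    have jc: "j \<in> carrier G" using j sub by auto
    have "u \<otimes> j \<otimes> w \<in> two_sided G {x}"
      using uvw j unfolding x(2)[symmetric] by (auto simp: set_mult_def)
    then obtain h where h: "h \<in> carrier G" "u \<otimes> j \<otimes> w = u \<otimes> v \<otimes> w \<otimes> h"
      using x(1) uvw by (auto simp: mem_two_sided_singleton_iff)
    \<comment> \<open>Moving \<open>h\<close> to the left of \<open>w\<close> puts \<open>w\<close>
      at the right end of both sides, ready to be cancelled.\<close>
    obtain h' where h': "h' \<in> carrier G" "w \<otimes> h = h' \<otimes> w"
      using ex_mult_commute_right[OF c(3) h(1)] .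
    have "u \<otimes> j \<otimes> w = u \<otimes> v \<otimes> (w \<otimes> h)"
      using h c by (simp add: m_assoc)
    also have "\<dots> = u \<otimes> (v \<otimes> h') \<otimes> w"
      using h' c by (simp add: m_assoc)
    finally have "u \<otimes> j = u \<otimes> (v \<otimes> h')"
      using c jc h' by (meson r_cancel m_closed)
    then have "j = v \<otimes> h'"
      using c jc h' by (meson l_cancel m_closed)
    then show ?thesis using h' c by (auto simp: mem_two_sided_singleton_iff)
  qed
  then have J: "J = two_sided G {v}"
    using abs uvw c by (auto simp: mem_two_sided_singleton_iff)
  \<comment> \<open>Bringing \<open>v\<close> to the front of uvw shows that \<open>v\<close>
    divides \<open>x\<close>.\<close>
  obtain v' where v': "v' \<in> carrier G" "u \<otimes> v = v \<otimes> v'"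
    using ex_mult_commute_left[OF c(2,1)] .
  have "x = v \<otimes> (v' \<otimes> w)"
    using uvw v' c by (simp add: m_assoc)
  then have "x \<in> two_sided G {v}"
    using v' c by (auto simp: mem_two_sided_singleton_iff)
  with c J that show thesis by blast
qed

text \<open>The test submonoid for the converse. Products stay inside because the exponents of
  \<open>b\<close> add; divisors stay inside because they are again principal, and their generators
  divide \<open>x\<close> and hence a power of \<open>b\<close>.\<close>

lemma divisor_closed_submonoid_power_divisors:
  assumes cancel: "monoid_cancel G" and b: "b \<in> carrier G"
  shows "divisor_closed_submonoid
    {two_sided G {x} | x. x \<in> carrier G \<and> (\<exists>n::nat. b [^] n \<in> two_sided G {x})}
    (fin_ideal_monoid G)" (is "divisor_closed_submonoid ?T _")
proof -
  have sub: "?T \<subseteq> fin_gen_ideals G"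
    using principal_ideals_subset_fin_gen_ideals by (auto simp: principal_ideals_def)
  have "carrier G \<in> ?T"
    using b by (auto simp: two_sided_one intro!: exI[of _ \<one>])
  moreover have "I <#> J \<in> ?T" if IJ: "I \<in> ?T" "J \<in> ?T" for I J
  proof -
    obtain x y and m n :: nat where
      x: "I = two_sided G {x}" "x \<in> carrier G" "b [^] m \<in> two_sided G {x}" and
      y: "J = two_sided G {y}" "y \<in> carrier G" "b [^] n \<in> two_sided G {y}"
      using IJ by blast
    have "b [^] (m + n) = b [^] m \<otimes> b [^] n"
      using b by (simp add: nat_pow_mult)
    also have "\<dots> \<in> two_sided G {x} <#> two_sided G {y}"
      using x y by (auto simp: set_mult_def)
    finally have "b [^] (m + n) \<in> two_sided G {x \<otimes> y}"
      using x y by (simp add: two_sided_singleton_mult)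
    then show ?thesis
      using x y two_sided_singleton_mult by blast
  qed
  ultimately have "submonoid ?T (fin_ideal_monoid G)"
    using sub by unfold_locales
      (simp_all only: fin_gen_ideals_carrier mult_fin_ideal_monoid one_fin_ideal_monoid)
  moreover have "J \<in> ?T"
    if J: "J \<in> carrier (fin_ideal_monoid G)" and L: "L \<in> ?T"
      and d: "divides_two_sided (fin_ideal_monoid G) J L" for J L
  proof -
    obtain x and n :: nat where
      x: "L = two_sided G {x}" "x \<in> carrier G" "b [^] n \<in> two_sided G {x}"
      using L by blast
    obtain I K where IK: "I \<in> fin_gen_ideals G" "K \<in> fin_gen_ideals G" "I <#> J <#> K = L"
      using d unfolding divides_two_sided_def two_sided_def[of "fin_ideal_monoid G"]
        fin_gen_ideals_carrier
      by (auto simp: set_mult_def[of "fin_ideal_monoid G"] mult_fin_ideal_monoid)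
    obtain v where v: "v \<in> carrier G" "J = two_sided G {v}" "x \<in> two_sided G {v}"
      using cancel_divisor_of_principal_ideal[OF cancel, of I J K x] IK J x
        monoid_ideal_fin_gen fin_gen_ideals_carrier by metis
    have "two_sided G {x} \<subseteq> two_sided G {v}"
      using two_sided_power_mono[of x v 1 1] v x by simp
    with x v show ?thesis by blast
  qed
  ultimately show ?thesis
    unfolding divisor_closed_submonoid_def by blast
qed

lemma cancel_archimedean:
  assumes cancel: "monoid_cancel G"
    and T: "\<And>T. divisor_closed_submonoid T (fin_ideal_monoid G) \<Longrightarrow>
      T \<noteq> {\<one>\<^bsub>fin_ideal_monoid G\<^esub>} \<Longrightarrow> principal_ideal_submonoid G \<subseteq> T"
  shows "archimedean_monoid G"
  unfolding archimedean_monoid_def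
proof (intro ballI impI)
  fix a b assume a: "a \<in> carrier G" and b: "b \<in> carrier G" "b \<notin> Units G"
  let ?T = "{two_sided G {x} | x. x \<in> carrier G \<and> (\<exists>n::nat. b [^] n \<in> two_sided G {x})}"
  \<comment> \<open>The ideal bH witnesses non-triviality: it differs from H because
    \<open>b\<close> is not a unit.\<close>
  have "b [^] (1::nat) \<in> two_sided G {b}"
    using b subset_two_sided[of "{b}"] by simp
  then have "two_sided G {b} \<in> ?T"
    using b by blast
  moreover have "two_sided G {b} \<noteq> carrier G"
    using b two_sided_singleton_eq_carrier_iff by blast
  ultimately have "?T \<noteq> {\<one>\<^bsub>fin_ideal_monoid G\<^esub>}"
    unfolding one_fin_ideal_monoid by blast
  then have "principal_ideal_submonoid G \<subseteq> ?T"
    by (intro T divisor_closed_submonoid_power_divisors cancel b)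
  moreover have "two_sided G {a} \<in> principal_ideal_submonoid G"
    using a unfolding principal_ideal_submonoid_def
    by (intro submonoid_gen.incl) (auto simp: principal_ideals_def)
  ultimately obtain n :: nat where n: "b [^] n \<in> two_sided G {a}"
    by blast
  \<comment> \<open>The exponent \<open>n\<close> obtained from \<open>?T\<close> may be 0, while
    the Archimedean property asks for a positive one.\<close>
  have "b [^] Suc n \<in> two_sided G {b [^] Suc n}"
    using b subset_two_sided[of "{b [^] Suc n}"] by simp
  then have "b [^] Suc n \<in> two_sided G {a}"
    using two_sided_power_mono[OF b(1) a n, of "Suc n"] by auto
  then show "\<exists>k::nat. k \<ge> 1 \<and> b [^] k \<in> two_sided G {a}"
    by (intro exI[of _ "Suc n"]) simp
qed

end

theorem proposition22:
  fixes H :: "('a, 'b) monoid_scheme"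
  assumes "duo_monoid H"
  shows "(archimedean_monoid H \<longrightarrow>
      (\<forall>T. divisor_closed_submonoid T (fin_ideal_monoid H) \<and> T \<noteq> {\<one>\<^bsub>fin_ideal_monoid H\<^esub>} \<longrightarrow>
        principal_ideal_submonoid H \<subseteq> T)) \<and>
    (monoid_cancel H \<and>
      (\<forall>T. divisor_closed_submonoid T (fin_ideal_monoid H) \<and> T \<noteq> {\<one>\<^bsub>fin_ideal_monoid H\<^esub>} \<longrightarrow>
        principal_ideal_submonoid H \<subseteq> T) \<longrightarrow>
      archimedean_monoid H)"
proof -
  interpret duo_monoid H by fact
  show ?thesis
    using archimedean_divisor_closed_contains_principal cancel_archimedean by blast
qed

end
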